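(* Let $D$ be a division algebra of degree $d$ with center $F$, and suppose $D$ has a maximal subfield $K$ that is Galois over $F$, with $\Gamma=\mathrm{Gal}(K|F)$. Let $\{x_\sigma\}_{\sigma\in\Gamma}$ be a crossed product basis of $D$ as a right $K$-vector space, and use it to regard $D^\times$ as a subgroup of $\mathrm{GL}_d(K)$ via left multiplication on $D$. Let $N\le\mathrm{GL}_d(K)$ be the subgroup of monomial matrices and $T$ the subgroup of invertible diagonal matrices (the stabilizer and fixer of the fundamental apartment $\Sigma_0$ of the spherical building of $\mathrm{GL}_d(K)$), and let $W_{D^\times}=\mathrm{Stab}_{D^\times}(\Sigma_0)/\mathrm{Fix}_{D^\times}(\Sigma_0)=(D^\times\cap N)/(D^\times\cap T)$. Then the injective homomorphism $\phi\colon\Gamma\to W_{D^\times}$, $\sigma\mapsto x_\sigma\,\mathrm{Fix}_{D^\times}(\Sigma_0)$, is surjective, and so is a canonical isomorphism.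
   Context: $D$ has degree $d$ if $\dim_F(D)=d^2$; a maximal subfield $K$ then has $[K:F]=d$. A crossed product basis is a basis $\{x_\sigma\}_{\sigma\in\Gamma}$ of $D$ as a right $K$-vector space, with $x_\sigma\in D^\times$, whose multiplication satisfies $x_\sigma x_\tau=x_{\sigma\tau}a_{\sigma,\tau}$ for some $a_{\sigma,\tau}\in K^\times$, and $bx_\sigma=x_\sigma\sigma(b)$ for all $b\in K$, $\sigma,\tau\in\Gamma$. For these rules to be compatible, the product in $\Gamma$ is read so that $(\sigma\tau)(b)=\tau(\sigma(b))$ for $b\in K$. Such a basis exists, and each $x_\sigma$ is unique up to right multiplication by an element of $K^\times$; "canonical" means that $\phi$ does not depend on the choice of the basis. Left multiplication by elements of $D^\times$ on the $d$-dimensional right $K$-vector space $D$ is $K$-linear and gives an injective homomorphism $D^\times\hookrightarrow\mathrm{GL}_d(K)$, where matrices are taken with respect to the basis $\{x_\sigma\}$. Thus $D^\times\cap N$ consists of the $z\in D^\times$ for which left multiplication by $z$ permutes the lines $x_\tau K$ ($\tau\in\Gamma$), and $D^\times\cap T$ of those for which it maps every line $x_\tau K$ to itself. The quotient $W_{D^\times}$ is a subgroup of $N/T\cong S_d$. *)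

theory Defs
  imports "HOL-Algebra.Algebra"
begin

section \<open>Division algebras, maximal subfields and Galois groups\<close>

definition ring_center :: "('a, 'm) ring_scheme \<Rightarrow> 'a set" where
  "ring_center R = {z \<in> carrier R. \<forall>a \<in> carrier R. z \<otimes>\<^bsub>R\<^esub> a = a \<otimes>\<^bsub>R\<^esub> z}"

locale division_algebra = ring D for D (structure) +
  fixes F :: "'a set" and d :: nat
  assumes division: "Units D = carrier D - {\<zero>}"
    and center: "F = ring_center D"
    and degree: "dimension (d\<^sup>2) F (carrier D)"

definition maximal_subfield :: "'a set \<Rightarrow> ('a, 'm) ring_scheme \<Rightarrow> bool" where
  "maximal_subfield K R \<longleftrightarrow> subfield K R \<and> (\<forall>L. subfield L R \<and> K \<subseteq> L \<longrightarrow> L = K)"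

text \<open>
  Elements of the Galois group are extensional on \<open>K\<close>, so that distinct functions are distinct
  automorphisms. The product is the opposite of the usual one: \<open>\<sigma>\<tau>\<close> is the map
  \<open>b \<mapsto> \<tau> (\<sigma> b)\<close>, as required for compatibility with right crossed product bases.
\<close>

definition Gal :: "('a, 'm) ring_scheme \<Rightarrow> 'a set \<Rightarrow> 'a set \<Rightarrow> ('a \<Rightarrow> 'a) monoid" where
  "Gal R F K =
    \<lparr>carrier = {\<sigma> \<in> extensional K.
        \<sigma> \<in> ring_iso (R\<lparr>carrier := K\<rparr>) (R\<lparr>carrier := K\<rparr>) \<and> (\<forall>b \<in> F. \<sigma> b = b)},
     monoid.mult = (\<lambda>\<sigma> \<tau>. compose K \<tau> \<sigma>),
     one = (\<lambda>b \<in> K. b)\<rparr>"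

definition galois_extension :: "('a, 'm) ring_scheme \<Rightarrow> 'a set \<Rightarrow> 'a set \<Rightarrow> bool" where
  "galois_extension R F K \<longleftrightarrow> F \<subseteq> K \<and> (\<exists>n. ring.dimension R n F K) \<and>
    {b \<in> K. \<forall>\<sigma> \<in> carrier (Gal R F K). \<sigma> b = b} = F"


section \<open>Right bases and crossed product bases\<close>

definition right_basis ::
    "('a, 'm) ring_scheme \<Rightarrow> 'a set \<Rightarrow> 'i set \<Rightarrow> ('i \<Rightarrow> 'a) \<Rightarrow> bool" where
  "right_basis D K I x \<longleftrightarrow> finite I \<and> x \<in> I \<rightarrow> carrier D \<and>
    (\<forall>v \<in> carrier D. \<exists>c \<in> I \<rightarrow> K. v = (\<Oplus>\<^bsub>D\<^esub>i\<in>I. x i \<otimes>\<^bsub>D\<^esub> c i)) \<and>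
    (\<forall>c \<in> I \<rightarrow> K. (\<Oplus>\<^bsub>D\<^esub>i\<in>I. x i \<otimes>\<^bsub>D\<^esub> c i) = \<zero>\<^bsub>D\<^esub> \<longrightarrow> (\<forall>i \<in> I. c i = \<zero>\<^bsub>D\<^esub>))"

definition crossed_product_basis ::
    "('a, 'm) ring_scheme \<Rightarrow> 'a set \<Rightarrow> 'a set \<Rightarrow> (('a \<Rightarrow> 'a) \<Rightarrow> 'a) \<Rightarrow> bool" where
  "crossed_product_basis D F K x \<longleftrightarrow>
    right_basis D K (carrier (Gal D F K)) x \<and>
    (\<forall>\<sigma> \<in> carrier (Gal D F K). x \<sigma> \<in> Units D) \<and>
    (\<forall>\<sigma> \<in> carrier (Gal D F K). \<forall>\<tau> \<in> carrier (Gal D F K).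
       \<exists>a \<in> K - {\<zero>\<^bsub>D\<^esub>}. x \<sigma> \<otimes>\<^bsub>D\<^esub> x \<tau> = x (\<sigma> \<otimes>\<^bsub>Gal D F K\<^esub> \<tau>) \<otimes>\<^bsub>D\<^esub> a) \<and>
    (\<forall>\<sigma> \<in> carrier (Gal D F K). \<forall>b \<in> K. b \<otimes>\<^bsub>D\<^esub> x \<sigma> = x \<sigma> \<otimes>\<^bsub>D\<^esub> \<sigma> b)"


section \<open>General linear groups over a finite index set\<close>

definition matrix_monoid ::
    "'i set \<Rightarrow> ('a, 'm) ring_scheme \<Rightarrow> ('i \<times> 'i \<Rightarrow> 'a) monoid" where
  "matrix_monoid I R =
    \<lparr>carrier = I \<times> I \<rightarrow>\<^sub>E carrier R,
     monoid.mult = (\<lambda>A B. \<lambda>(i, j) \<in> I \<times> I. \<Oplus>\<^bsub>R\<^esub>k\<in>I. A (i, k) \<otimes>\<^bsub>R\<^esub> B (k, j)),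
     one = (\<lambda>(i, j) \<in> I \<times> I. if i = j then \<one>\<^bsub>R\<^esub> else \<zero>\<^bsub>R\<^esub>)\<rparr>"

definition GL :: "'i set \<Rightarrow> ('a, 'm) ring_scheme \<Rightarrow> ('i \<times> 'i \<Rightarrow> 'a) monoid" where
  "GL I R = units_of (matrix_monoid I R)"

definition monomial_matrices :: "'i set \<Rightarrow> ('a, 'm) ring_scheme \<Rightarrow> ('i \<times> 'i \<Rightarrow> 'a) set" where
  "monomial_matrices I R = {A \<in> carrier (GL I R).
     (\<forall>i \<in> I. \<exists>!j. j \<in> I \<and> A (i, j) \<noteq> \<zero>\<^bsub>R\<^esub>) \<and> (\<forall>j \<in> I. \<exists>!i. i \<in> I \<and> A (i, j) \<noteq> \<zero>\<^bsub>R\<^esub>)}"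

definition diagonal_matrices :: "'i set \<Rightarrow> ('a, 'm) ring_scheme \<Rightarrow> ('i \<times> 'i \<Rightarrow> 'a) set" where
  "diagonal_matrices I R = {A \<in> carrier (GL I R).
     \<forall>i \<in> I. \<forall>j \<in> I. i \<noteq> j \<longrightarrow> A (i, j) = \<zero>\<^bsub>R\<^esub>}"


section \<open>The embedding by left multiplication\<close>

text \<open>
  Column \<open>j\<close> of \<open>lmult_matrix D K I x z\<close> consists of the right coordinates of \<open>z x\<^sub>j\<close>, that is,
  \<open>z x\<^sub>j = \<Sum>\<^sub>i x\<^sub>i M\<^sub>i\<^sub>j\<close> with \<open>M\<^sub>i\<^sub>j \<in> K\<close>.
\<close>

definition coords ::
    "('a, 'm) ring_scheme \<Rightarrow> 'a set \<Rightarrow> 'i set \<Rightarrow> ('i \<Rightarrow> 'a) \<Rightarrow> 'a \<Rightarrow> 'i \<Rightarrow> 'a" where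
  "coords D K I x v =
    (THE c. c \<in> I \<rightarrow>\<^sub>E K \<and> v = (\<Oplus>\<^bsub>D\<^esub>i\<in>I. x i \<otimes>\<^bsub>D\<^esub> c i))"

definition lmult_matrix ::
    "('a, 'm) ring_scheme \<Rightarrow> 'a set \<Rightarrow> 'i set \<Rightarrow> ('i \<Rightarrow> 'a) \<Rightarrow> 'a \<Rightarrow> 'i \<times> 'i \<Rightarrow> 'a" where
  "lmult_matrix D K I x z = (\<lambda>(i, j) \<in> I \<times> I. coords D K I x (z \<otimes>\<^bsub>D\<^esub> x j) i)"

text \<open>
  \<open>D\<^sup>\<times>\<close> is regarded as a subgroup of the general linear group over \<open>K\<close> via \<^const>\<open>lmult_matrix\<close>
  (see \<open>lmult_matrix_hom\<close> and \<open>lmult_matrix_inj\<close> below), so that intersections with \<open>D\<^sup>\<times>\<close> are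
  preimages under this map.
\<close>

definition stab_units ::
    "('a, 'm) ring_scheme \<Rightarrow> 'a set \<Rightarrow> 'a set \<Rightarrow> (('a \<Rightarrow> 'a) \<Rightarrow> 'a) \<Rightarrow> 'a set" where
  "stab_units D F K x = {z \<in> Units D. lmult_matrix D K (carrier (Gal D F K)) x z
     \<in> monomial_matrices (carrier (Gal D F K)) (D\<lparr>carrier := K\<rparr>)}"

definition fix_units ::
    "('a, 'm) ring_scheme \<Rightarrow> 'a set \<Rightarrow> 'a set \<Rightarrow> (('a \<Rightarrow> 'a) \<Rightarrow> 'a) \<Rightarrow> 'a set" where
  "fix_units D F K x = {z \<in> Units D. lmult_matrix D K (carrier (Gal D F K)) x z
     \<in> diagonal_matrices (carrier (Gal D F K)) (D\<lparr>carrier := K\<rparr>)}"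

definition stab_group ::
    "('a, 'm) ring_scheme \<Rightarrow> 'a set \<Rightarrow> 'a set \<Rightarrow> (('a \<Rightarrow> 'a) \<Rightarrow> 'a) \<Rightarrow> 'a monoid" where
  "stab_group D F K x = (units_of D)\<lparr>carrier := stab_units D F K x\<rparr>"

definition weyl_group ::
    "('a, 'm) ring_scheme \<Rightarrow> 'a set \<Rightarrow> 'a set \<Rightarrow> (('a \<Rightarrow> 'a) \<Rightarrow> 'a) \<Rightarrow> 'a set monoid" where
  "weyl_group D F K x = stab_group D F K x Mod fix_units D F K x"

definition gal_to_weyl ::
    "('a, 'm) ring_scheme \<Rightarrow> 'a set \<Rightarrow> 'a set \<Rightarrow> (('a \<Rightarrow> 'a) \<Rightarrow> 'a) \<Rightarrow> ('a \<Rightarrow> 'a) \<Rightarrow> 'a set" where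
  "gal_to_weyl D F K x \<sigma> = x \<sigma> <#\<^bsub>units_of D\<^esub> fix_units D F K x"

context ring
begin

lemma finsum_single:
  assumes "finite I" "j \<in> I" "v \<in> carrier R" "\<And>i. i \<in> I \<Longrightarrow> f i = (if i = j then v else \<zero>)"
  shows "(\<Oplus>i\<in>I. f i) = v"
proof -
  have "(\<Oplus>i\<in>I. f i) = (\<Oplus>i\<in>I. if j = i then (\<lambda>_. v) i else \<zero>)"
    by (rule finsum_cong') (use assms in auto)
  also have "\<dots> = v" using assms by (subst finsum_singleton) auto
  finally show ?thesis .
qed

lemma finsum_swap:
  assumes "finite I" "finite J" "\<And>i j. i \<in> I \<Longrightarrow> j \<in> J \<Longrightarrow> f i j \<in> carrier R"
  shows "(\<Oplus>i\<in>I. \<Oplus>j\<in>J. f i j) = (\<Oplus>j\<in>J. \<Oplus>i\<in>I. f i j)"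
  using assms(1,3)
proof (induction I)
  case empty
  then show ?case by (simp add: finsum_zero)
next
  case (insert a I)
  have "(\<Oplus>j\<in>J. \<Oplus>i\<in>insert a I. f i j) = (\<Oplus>j\<in>J. f a j \<oplus> (\<Oplus>i\<in>I. f i j))"
    by (rule finsum_cong') (use insert in \<open>auto intro!: finsum_closed simp: finsum_insert\<close>)
  also have "\<dots> = (\<Oplus>j\<in>J. f a j) \<oplus> (\<Oplus>j\<in>J. \<Oplus>i\<in>I. f i j)"
    by (rule finsum_addf) (use insert in \<open>auto intro!: finsum_closed\<close>)
  finally show ?case
    using insert by (subst finsum_insert) (auto intro!: finsum_closed)
qed

lemma finsum_subring:
  assumes "subring K R" "finite I" "f \<in> I \<rightarrow> K"
  shows "finsum (R\<lparr>carrier := K\<rparr>) f I = finsum R f I" "finsum R f I \<in> K"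
proof -
  interpret S: ring "R\<lparr>carrier := K\<rparr>" by (rule subring_is_ring[OF assms(1)])
  have sub: "K \<subseteq> carrier R" by (rule subringE(1)[OF assms(1)])
  have "finsum (R\<lparr>carrier := K\<rparr>) f I = finsum R f I \<and> finsum R f I \<in> K"
    using assms(2,3)
  proof (induction I)
    case empty
    then show ?case using subringE(2)[OF assms(1)] by simp
  next
    case (insert a I)
    have 1: "f a \<in> K" "f \<in> I \<rightarrow> K" using insert by auto
    have "finsum (R\<lparr>carrier := K\<rparr>) f (insert a I)
        = f a \<oplus>\<^bsub>R\<lparr>carrier := K\<rparr>\<^esub> finsum (R\<lparr>carrier := K\<rparr>) f I"
      by (rule S.finsum_insert) (use insert 1 in auto)
    moreover have "finsum R f (insert a I) = f a \<oplus> finsum R f I"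
      by (rule finsum_insert) (use insert 1 sub in auto)
    ultimately show ?case using insert.IH[OF 1(2)] 1 subringE(7)[OF assms(1)] by simp
  qed
  then show "finsum (R\<lparr>carrier := K\<rparr>) f I = finsum R f I" "finsum R f I \<in> K" by auto
qed

lemma coords_unique:
  assumes K: "subring K R" and B: "right_basis R K I x"
    and c: "c \<in> I \<rightarrow> K" "e \<in> I \<rightarrow> K" "(\<Oplus>i\<in>I. x i \<otimes> c i) = (\<Oplus>i\<in>I. x i \<otimes> e i)" and i: "i \<in> I"
  shows "c i = e i"
proof -
  have sub: "K \<subseteq> carrier R" by (rule subringE(1)[OF K])
  have x: "\<And>i. i \<in> I \<Longrightarrow> x i \<in> carrier R" and fin: "finite I"
    using B unfolding right_basis_def by auto
  have cc: "\<And>i. i \<in> I \<Longrightarrow> c i \<in> carrier R" "\<And>i. i \<in> I \<Longrightarrow> e i \<in> carrier R" using c sub by auto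
  have "(\<Oplus>i\<in>I. x i \<otimes> c i) = (\<Oplus>i\<in>I. x i \<otimes> (c i \<ominus> e i) \<oplus> x i \<otimes> e i)"
    by (rule finsum_cong') (use x cc in \<open>auto simp: minus_eq r_distr r_minus a_assoc l_neg\<close>)
  also have "\<dots> = (\<Oplus>i\<in>I. x i \<otimes> (c i \<ominus> e i)) \<oplus> (\<Oplus>i\<in>I. x i \<otimes> e i)"
    by (rule finsum_addf) (use x cc in auto)
  finally have "(\<Oplus>i\<in>I. x i \<otimes> (c i \<ominus> e i)) \<oplus> (\<Oplus>i\<in>I. x i \<otimes> e i) = (\<Oplus>i\<in>I. x i \<otimes> e i)"
    using c(3) by simp
  moreover have cl: "(\<Oplus>i\<in>I. x i \<otimes> (c i \<ominus> e i)) \<in> carrier R" "(\<Oplus>i\<in>I. x i \<otimes> e i) \<in> carrier R"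
    by (rule finsum_closed; use x cc in auto)+
  ultimately have "(\<Oplus>i\<in>I. x i \<otimes> (c i \<ominus> e i)) = \<zero>"
    by (metis add.r_cancel_one')
  moreover have "(\<lambda>i. c i \<ominus> e i) \<in> I \<rightarrow> K"
  proof
    fix k assume "k \<in> I"
    then have "c k \<in> K" "e k \<in> K" using c by auto
    then show "c k \<ominus> e k \<in> K" unfolding minus_eq by (intro subringE(5,7)[OF K])
  qed
  moreover have "\<forall>c \<in> I \<rightarrow> K. (\<Oplus>i\<in>I. x i \<otimes> c i) = \<zero> \<longrightarrow> (\<forall>i \<in> I. c i = \<zero>)"
    using B unfolding right_basis_def by blast
  ultimately have "\<forall>i \<in> I. c i \<ominus> e i = \<zero>"
    by (drule_tac x = "\<lambda>i. c i \<ominus> e i" in bspec) auto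
  then have "c i \<ominus> e i = \<zero>" using i by blast
  then show ?thesis using cc[OF i] by simp
qed

lemma coords_eqI:
  assumes K: "subring K R" and B: "right_basis R K I x"
    and c: "c \<in> I \<rightarrow> K" "v = (\<Oplus>i\<in>I. x i \<otimes> c i)" and i: "i \<in> I"
  shows "coords R K I x v i = c i"
proof -
  have sub: "K \<subseteq> carrier R" by (rule subringE(1)[OF K])
  have x: "\<And>i. i \<in> I \<Longrightarrow> x i \<in> carrier R" using B unfolding right_basis_def by auto
  have "coords R K I x v = restrict c I"
    unfolding coords_def
  proof (rule the_equality)
    show "restrict c I \<in> I \<rightarrow>\<^sub>E K \<and> v = (\<Oplus>i\<in>I. x i \<otimes> restrict c I i)"
      unfolding c(2) using c(1) sub x by (auto intro!: finsum_cong')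
  next
    fix e assume e: "e \<in> I \<rightarrow>\<^sub>E K \<and> v = (\<Oplus>i\<in>I. x i \<otimes> e i)"
    show "e = restrict c I"
    proof
      fix i show "e i = restrict c I i"
        using coords_unique[OF K B, of e c i] e c by (cases "i \<in> I") (auto simp: PiE_def extensional_def)
    qed
  qed
  then show ?thesis using i by simp
qed

lemma coords:
  assumes K: "subring K R" and B: "right_basis R K I x" and v: "v \<in> carrier R"
  shows "i \<in> I \<Longrightarrow> coords R K I x v i \<in> K" "(\<Oplus>i\<in>I. x i \<otimes> coords R K I x v i) = v"
proof -
  have sub: "K \<subseteq> carrier R" by (rule subringE(1)[OF K])
  have x: "\<And>i. i \<in> I \<Longrightarrow> x i \<in> carrier R" using B unfolding right_basis_def by auto
  obtain c where c: "c \<in> I \<rightarrow> K" "v = (\<Oplus>i\<in>I. x i \<otimes> c i)"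
    using B v unfolding right_basis_def by blast
  note eq = coords_eqI[OF K B c]
  show "coords R K I x v i \<in> K" if "i \<in> I" using eq[OF that] c that by auto
  have "(\<Oplus>i\<in>I. x i \<otimes> coords R K I x v i) = (\<Oplus>i\<in>I. x i \<otimes> c i)"
    by (rule finsum_cong') (use x c eq sub in auto)
  then show "(\<Oplus>i\<in>I. x i \<otimes> coords R K I x v i) = v" using c by simp
qed

lemma lmult_matrix_carrier:
  assumes "subring K R" "right_basis R K I x" "z \<in> carrier R"
  shows "lmult_matrix R K I x z \<in> carrier (matrix_monoid I (R\<lparr>carrier := K\<rparr>))"
proof -
  have "\<And>i. i \<in> I \<Longrightarrow> x i \<in> carrier R" using assms(2) unfolding right_basis_def by auto
  then show ?thesis
    using assms(3) coords(1)[OF assms(1,2)] unfolding lmult_matrix_def matrix_monoid_def by auto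
qed

lemma lmult_matrix_column:
  assumes K: "subring K R" and B: "right_basis R K I x" and z: "z \<in> carrier R" and j: "j \<in> I"
  shows "(\<Oplus>i\<in>I. x i \<otimes> lmult_matrix R K I x z (i, j)) = z \<otimes> x j"
proof -
  have x: "\<And>i. i \<in> I \<Longrightarrow> x i \<in> carrier R" using B unfolding right_basis_def by auto
  have sub: "K \<subseteq> carrier R" by (rule subringE(1)[OF K])
  have "(\<Oplus>i\<in>I. x i \<otimes> lmult_matrix R K I x z (i, j)) = (\<Oplus>i\<in>I. x i \<otimes> coords R K I x (z \<otimes> x j) i)"
    by (rule finsum_cong')
      (use j x z sub coords(1)[OF K B, of "z \<otimes> x j"] in \<open>auto simp: lmult_matrix_def\<close>)
  then show ?thesis using coords(2)[OF K B, of "z \<otimes> x j"] x j z by simp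
qed

lemma lmult_matrix_one:
  assumes K: "subring K R" and B: "right_basis R K I x"
  shows "lmult_matrix R K I x \<one> = \<one>\<^bsub>matrix_monoid I (R\<lparr>carrier := K\<rparr>)\<^esub>"
proof -
  have x: "\<And>i. i \<in> I \<Longrightarrow> x i \<in> carrier R" and fin: "finite I"
    using B unfolding right_basis_def by auto
  have "coords R K I x (\<one> \<otimes> x j) i = (if i = j then \<one> else \<zero>)" if "i \<in> I" "j \<in> I" for i j
  proof (rule coords_eqI[OF K B _ _ that(1), where c = "\<lambda>i. if i = j then \<one> else \<zero>"])
    show "(\<lambda>i. if i = j then \<one> else \<zero>) \<in> I \<rightarrow> K" using subringE(2,3)[OF K] by auto
    have "(\<Oplus>i\<in>I. x i \<otimes> (if i = j then \<one> else \<zero>)) = x j"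
      by (rule finsum_single[OF fin that(2)]) (use x that in auto)
    then show "\<one> \<otimes> x j = (\<Oplus>i\<in>I. x i \<otimes> (if i = j then \<one> else \<zero>))" using x that by simp
  qed
  then show ?thesis unfolding lmult_matrix_def matrix_monoid_def by (auto intro!: restrict_ext)
qed

lemma lmult_matrix_mult:
  assumes K: "subring K R" and B: "right_basis R K I x" and z: "z \<in> carrier R" and w: "w \<in> carrier R"
  shows "lmult_matrix R K I x (z \<otimes> w)
    = lmult_matrix R K I x z \<otimes>\<^bsub>matrix_monoid I (R\<lparr>carrier := K\<rparr>)\<^esub> lmult_matrix R K I x w"
proof -
  have x: "\<And>i. i \<in> I \<Longrightarrow> x i \<in> carrier R" and fin: "finite I"
    using B unfolding right_basis_def by auto
  have sub: "K \<subseteq> carrier R" by (rule subringE(1)[OF K])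
  let ?Z = "lmult_matrix R K I x z" and ?W = "lmult_matrix R K I x w"
  have Z: "?Z (i, j) \<in> K" "?W (i, j) \<in> K" if "i \<in> I" "j \<in> I" for i j
    using that lmult_matrix_carrier[OF K B z] lmult_matrix_carrier[OF K B w]
    by (auto simp: matrix_monoid_def)
  have Zc: "?Z (i, j) \<in> carrier R" "?W (i, j) \<in> carrier R" if "i \<in> I" "j \<in> I" for i j
    using Z[OF that] sub by auto
  have mem: "(\<lambda>k. ?Z (i, k) \<otimes> ?W (k, j)) \<in> I \<rightarrow> K" if "i \<in> I" "j \<in> I" for i j
    using Z that subringE(6)[OF K] by auto
  have "coords R K I x ((z \<otimes> w) \<otimes> x j) i = (\<Oplus>k\<in>I. ?Z (i, k) \<otimes> ?W (k, j))"
    if "i \<in> I" "j \<in> I" for i j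
  proof (rule coords_eqI[OF K B _ _ that(1)])
    show "(\<lambda>i. \<Oplus>k\<in>I. ?Z (i, k) \<otimes> ?W (k, j)) \<in> I \<rightarrow> K"
      using finsum_subring(2)[OF K fin mem] that by auto
    have "(z \<otimes> w) \<otimes> x j = z \<otimes> (\<Oplus>k\<in>I. x k \<otimes> ?W (k, j))"
      using lmult_matrix_column[OF K B w that(2)] z w x that by (simp add: m_assoc)
    also have "\<dots> = (\<Oplus>k\<in>I. z \<otimes> (x k \<otimes> ?W (k, j)))"
      by (rule finsum_rdistr[OF fin z]) (use x Zc that in auto)
    also have "\<dots> = (\<Oplus>k\<in>I. \<Oplus>i\<in>I. x i \<otimes> (?Z (i, k) \<otimes> ?W (k, j)))"
    proof (rule finsum_cong')
      fix k assume k: "k \<in> I"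
      have "z \<otimes> (x k \<otimes> ?W (k, j)) = (\<Oplus>i\<in>I. x i \<otimes> ?Z (i, k)) \<otimes> ?W (k, j)"
        using lmult_matrix_column[OF K B z k] x k z Zc that by (simp add: m_assoc)
      also have "\<dots> = (\<Oplus>i\<in>I. x i \<otimes> ?Z (i, k) \<otimes> ?W (k, j))"
        by (rule finsum_ldistr[OF fin]) (use x Zc that k in auto)
      also have "\<dots> = (\<Oplus>i\<in>I. x i \<otimes> (?Z (i, k) \<otimes> ?W (k, j)))"
        by (rule finsum_cong') (use x Zc that k in \<open>auto simp: m_assoc\<close>)
      finally show "z \<otimes> (x k \<otimes> ?W (k, j)) = (\<Oplus>i\<in>I. x i \<otimes> (?Z (i, k) \<otimes> ?W (k, j)))" .
    qed (use x Zc that in \<open>auto intro!: finsum_closed\<close>)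
    also have "\<dots> = (\<Oplus>i\<in>I. \<Oplus>k\<in>I. x i \<otimes> (?Z (i, k) \<otimes> ?W (k, j)))"
      by (rule finsum_swap[OF fin fin]) (use x Zc that in auto)
    also have "\<dots> = (\<Oplus>i\<in>I. x i \<otimes> (\<Oplus>k\<in>I. ?Z (i, k) \<otimes> ?W (k, j)))"
      by (rule finsum_cong')
        (use x Zc that fin in \<open>auto intro!: finsum_closed finsum_rdistr[symmetric]\<close>)
    finally show "(z \<otimes> w) \<otimes> x j = (\<Oplus>i\<in>I. x i \<otimes> (\<Oplus>k\<in>I. ?Z (i, k) \<otimes> ?W (k, j)))" .
  qed
  moreover have "finsum (R\<lparr>carrier := K\<rparr>) (\<lambda>k. ?Z (i, k) \<otimes> ?W (k, j)) I = (\<Oplus>k\<in>I. ?Z (i, k) \<otimes> ?W (k, j))"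
    if "i \<in> I" "j \<in> I" for i j
    by (rule finsum_subring(1)[OF K fin mem[OF that]])
  ultimately show ?thesis
    by (subst (1) lmult_matrix_def) (auto simp: matrix_monoid_def intro!: restrict_ext)
qed

lemma lmult_matrix_hom:
  assumes K: "subring K R" and B: "right_basis R K I x"
  shows "lmult_matrix R K I x \<in> hom (units_of R) (GL I (R\<lparr>carrier := K\<rparr>))"
proof (rule homI)
  fix z assume "z \<in> carrier (units_of R)"
  then have z: "z \<in> Units R" by (simp add: units_of_def)
  then have i: "z \<in> carrier R" "inv z \<in> carrier R" by auto
  show "lmult_matrix R K I x z \<in> carrier (GL I (R\<lparr>carrier := K\<rparr>))"
    using lmult_matrix_carrier[OF K B] lmult_matrix_mult[OF K B] lmult_matrix_one[OF K B] i
      Units_l_inv[OF z] Units_r_inv[OF z]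
    unfolding GL_def units_of_def Units_def[of "matrix_monoid I (R\<lparr>carrier := K\<rparr>)"] by auto metis
next
  fix z w assume "z \<in> carrier (units_of R)" "w \<in> carrier (units_of R)"
  then show "lmult_matrix R K I x (z \<otimes>\<^bsub>units_of R\<^esub> w)
      = lmult_matrix R K I x z \<otimes>\<^bsub>GL I (R\<lparr>carrier := K\<rparr>)\<^esub> lmult_matrix R K I x w"
    using lmult_matrix_mult[OF K B, of z w] by (simp add: units_of_def GL_def Units_closed)
qed

lemma lmult_matrix_inj:
  assumes K: "subring K R" and B: "right_basis R K I x"
  shows "inj_on (lmult_matrix R K I x) (carrier R)"
proof (rule inj_onI)
  fix z w assume z: "z \<in> carrier R" "w \<in> carrier R"
    and eq: "lmult_matrix R K I x z = lmult_matrix R K I x w"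
  have x: "\<And>i. i \<in> I \<Longrightarrow> x i \<in> carrier R" and fin: "finite I"
    using B unfolding right_basis_def by auto
  have sub: "K \<subseteq> carrier R" by (rule subringE(1)[OF K])
  have zx: "z \<otimes> x j = w \<otimes> x j" if "j \<in> I" for j
    using lmult_matrix_column[OF K B z(1) that] lmult_matrix_column[OF K B z(2) that] eq by simp
  let ?c = "coords R K I x \<one>"
  have c: "\<And>i. i \<in> I \<Longrightarrow> ?c i \<in> carrier R" using coords(1)[OF K B] sub by auto
  have *: "y = (\<Oplus>i\<in>I. y \<otimes> x i \<otimes> ?c i)" if y: "y \<in> carrier R" for y
  proof -
    have "y = y \<otimes> (\<Oplus>i\<in>I. x i \<otimes> ?c i)" using coords(2)[OF K B] y by simp
    also have "\<dots> = (\<Oplus>i\<in>I. y \<otimes> (x i \<otimes> ?c i))" by (rule finsum_rdistr[OF fin y]) (use x c in auto)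
    also have "\<dots> = (\<Oplus>i\<in>I. y \<otimes> x i \<otimes> ?c i)"
      by (rule finsum_cong') (use x c y in \<open>auto simp: m_assoc\<close>)
    finally show ?thesis .
  qed
  have "(\<Oplus>i\<in>I. z \<otimes> x i \<otimes> ?c i) = (\<Oplus>i\<in>I. w \<otimes> x i \<otimes> ?c i)"
    by (rule finsum_cong') (use zx x c z in auto)
  then show "z = w" using *[OF z(1)] *[OF z(2)] by simp
qed

end

end

theory Submission
  imports Defs
begin

text \<open>
  Everything rests on computing the matrix of left multiplication by an arbitrary
  \<open>z = \<Sum>\<^sub>\<gamma> x\<^sub>\<gamma> c\<^sub>\<gamma>\<close>. The crossed product rules give
  \<open>z x\<^sub>\<tau> = \<Sum>\<^sub>\<gamma> x\<^sub>\<gamma>\<^sub>\<tau> a\<^sub>\<gamma>\<^sub>,\<^sub>\<tau> \<tau>(c\<^sub>\<gamma>)\<close>, and neither the nonzero factors \<open>a\<^sub>\<gamma>\<^sub>,\<^sub>\<tau>\<close> nor the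
  automorphisms \<open>\<tau>\<close> affect which terms vanish. The zero pattern of the matrix of \<open>z\<close> is therefore
  that of the group ring element \<open>\<Sum>\<^sub>\<gamma> c\<^sub>\<gamma> \<gamma>\<close> in the regular representation of the Galois group: its entry at \<open>(\<rho>, \<tau>)\<close> vanishes
  exactly when \<open>c\<close> vanishes at \<open>\<rho>\<tau>\<inverse>\<close> (\<open>lmult_matrix_eq_zero_iff\<close>).

  Every column thus has as many nonzero entries as \<open>z\<close> has nonzero coordinates. A monomial matrix
  has one nonzero entry in each column, so \<open>z = x\<^sub>\<gamma> k\<close> for a single \<open>\<gamma>\<close> and some \<open>k \<in> K\<^sup>\<times>\<close>
  (\<open>stab_units_eq\<close>); if the matrix is diagonal, then \<open>\<gamma> = 1\<close> and hence \<open>z \<in> K\<^sup>\<times>\<close>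
  (\<open>fix_units_eq\<close>). The stabilizer is therefore the disjoint union of the punctured lines
  \<open>x\<^sub>\<gamma> K\<^sup>\<times>\<close>, which are the cosets of the fixer \<open>K\<^sup>\<times>\<close> and are permuted by multiplication as the
  Galois group multiplies. This is the asserted isomorphism.

  For independence of the basis, comparing coordinates in \<open>b y = y \<gamma>(b)\<close> for all \<open>b \<in> K\<close> shows
  that any such \<open>y\<close> lies on the line \<open>x\<^sub>\<gamma> K\<close> (\<open>intertwiner_in_line\<close>). Two crossed product bases
  therefore define the same lines, and so the same stabilizer, fixer and cosets.
\<close>

section \<open>The Galois group\<close>

lemma Gal_carrier_iff:
  "\<gamma> \<in> carrier (Gal R F K) \<longleftrightarrow> \<gamma> \<in> extensional K \<and>
    \<gamma> \<in> ring_iso (R\<lparr>carrier := K\<rparr>) (R\<lparr>carrier := K\<rparr>) \<and> (\<forall>b \<in> F. \<gamma> b = b)"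
  by (simp add: Gal_def)

lemma Gal_mult: "\<gamma> \<otimes>\<^bsub>Gal R F K\<^esub> \<tau> = compose K \<tau> \<gamma>"
  by (simp add: Gal_def)

lemma Gal_one: "\<one>\<^bsub>Gal R F K\<^esub> = (\<lambda>b \<in> K. b)"
  by (simp add: Gal_def)

lemma Gal_group:
  assumes R: "ring R" and K: "subring K R" and F: "F \<subseteq> K"
  shows "group (Gal R F K)"
proof -
  interpret S: ring "R\<lparr>carrier := K\<rparr>" by (rule ring.subring_is_ring[OF R K])
  show ?thesis
  proof (rule groupI)
    fix \<gamma> \<tau> assume st: "\<gamma> \<in> carrier (Gal R F K)" "\<tau> \<in> carrier (Gal R F K)"
    then have "\<tau> \<circ> \<gamma> \<in> ring_iso (R\<lparr>carrier := K\<rparr>) (R\<lparr>carrier := K\<rparr>)"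
      by (auto simp: Gal_carrier_iff intro: ring_iso_set_trans)
    then have "compose K \<tau> \<gamma> \<in> ring_iso (R\<lparr>carrier := K\<rparr>) (R\<lparr>carrier := K\<rparr>)"
      by (rule S.ring_iso_restrict) (simp add: compose_eq)
    then show "\<gamma> \<otimes>\<^bsub>Gal R F K\<^esub> \<tau> \<in> carrier (Gal R F K)"
      using st F by (auto simp: Gal_carrier_iff Gal_mult compose_eq)
  next
    have "(\<lambda>b \<in> K. b) \<in> ring_iso (R\<lparr>carrier := K\<rparr>) (R\<lparr>carrier := K\<rparr>)"
      by (rule S.ring_iso_restrict[OF ring_iso_set_refl]) simp
    then show "\<one>\<^bsub>Gal R F K\<^esub> \<in> carrier (Gal R F K)"
      using F by (auto simp: Gal_carrier_iff Gal_one)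
  next
    fix \<rho> \<gamma> \<tau>
    assume "\<rho> \<in> carrier (Gal R F K)" "\<gamma> \<in> carrier (Gal R F K)" "\<tau> \<in> carrier (Gal R F K)"
    then have "\<rho> \<in> K \<rightarrow> K"
      using ring_iso_memE(1)[of \<rho> "R\<lparr>carrier := K\<rparr>" "R\<lparr>carrier := K\<rparr>"]
      by (auto simp: Gal_carrier_iff)
    then show "\<rho> \<otimes>\<^bsub>Gal R F K\<^esub> \<gamma> \<otimes>\<^bsub>Gal R F K\<^esub> \<tau> = \<rho> \<otimes>\<^bsub>Gal R F K\<^esub> (\<gamma> \<otimes>\<^bsub>Gal R F K\<^esub> \<tau>)"
      by (simp add: Gal_mult compose_assoc)
  next
    fix \<gamma> assume s: "\<gamma> \<in> carrier (Gal R F K)"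
    then have "\<gamma> \<in> K \<rightarrow> K"
      using ring_iso_memE(1)[of \<gamma> "R\<lparr>carrier := K\<rparr>" "R\<lparr>carrier := K\<rparr>"]
      by (auto simp: Gal_carrier_iff)
    then show "\<one>\<^bsub>Gal R F K\<^esub> \<otimes>\<^bsub>Gal R F K\<^esub> \<gamma> = \<gamma>"
      using s by (auto simp: Gal_mult Gal_one Gal_carrier_iff compose_def extensional_def)
  next
    fix \<gamma> assume s: "\<gamma> \<in> carrier (Gal R F K)"
    let ?\<rho> = "\<lambda>b \<in> K. inv_into K \<gamma> b"
    have iso: "\<gamma> \<in> ring_iso (R\<lparr>carrier := K\<rparr>) (R\<lparr>carrier := K\<rparr>)"
      using s by (simp add: Gal_carrier_iff)
    then have bij: "bij_betw \<gamma> K K" using ring_iso_memE(5)[OF iso] by simp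
    have "inv_into K \<gamma> \<in> ring_iso (R\<lparr>carrier := K\<rparr>) (R\<lparr>carrier := K\<rparr>)"
      using ring_iso_set_sym[OF S.ring_axioms iso] by simp
    then have "?\<rho> \<in> ring_iso (R\<lparr>carrier := K\<rparr>) (R\<lparr>carrier := K\<rparr>)"
      by (rule S.ring_iso_restrict) simp
    moreover have "inv_into K \<gamma> b = b" if "b \<in> F" for b
      using s that F bij by (intro inv_into_f_eq) (auto simp: Gal_carrier_iff bij_betw_def)
    ultimately have "?\<rho> \<in> carrier (Gal R F K)"
      using F by (auto simp: Gal_carrier_iff)
    moreover have "?\<rho> \<otimes>\<^bsub>Gal R F K\<^esub> \<gamma> = \<one>\<^bsub>Gal R F K\<^esub>"
      using bij by (auto simp: Gal_mult Gal_one compose_def bij_betw_inv_into_right)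
    ultimately show "\<exists>\<rho> \<in> carrier (Gal R F K). \<rho> \<otimes>\<^bsub>Gal R F K\<^esub> \<gamma> = \<one>\<^bsub>Gal R F K\<^esub>" by blast
  qed
qed


section \<open>The arithmetic of a crossed product basis\<close>

locale crossed_product = ring D for D (structure) +
  fixes F K :: "'a set" and x :: "('a \<Rightarrow> 'a) \<Rightarrow> 'a"
  assumes subfield: "subfield K D"
    and fixed_le: "F \<subseteq> K"
    and crossed_product_basis: "crossed_product_basis D F K x"
begin

abbreviation \<Gamma> :: "('a \<Rightarrow> 'a) monoid" where "\<Gamma> \<equiv> Gal D F K"

abbreviation coord :: "'a \<Rightarrow> ('a \<Rightarrow> 'a) \<Rightarrow> 'a" where
  "coord \<equiv> coords D K (carrier \<Gamma>) x"

abbreviation mat :: "'a \<Rightarrow> ('a \<Rightarrow> 'a) \<times> ('a \<Rightarrow> 'a) \<Rightarrow> 'a" where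
  "mat \<equiv> lmult_matrix D K (carrier \<Gamma>) x"

lemmas subring = subfieldE(1)[OF subfield]

lemma in_carrier: "b \<in> K \<Longrightarrow> b \<in> carrier D"
  using subfieldE(3)[OF subfield] by blast

sublocale Galois: group \<Gamma>
  by (rule Gal_group[OF ring_axioms subring fixed_le])

lemma basis: "right_basis D K (carrier \<Gamma>) x"
  using crossed_product_basis by (simp add: crossed_product_basis_def)

lemma finite_Gal: "finite (carrier \<Gamma>)"
  using basis by (simp add: right_basis_def)

lemma x_unit: "\<gamma> \<in> carrier \<Gamma> \<Longrightarrow> x \<gamma> \<in> Units D"
  using crossed_product_basis by (simp add: crossed_product_basis_def)

lemma x_carrier: "\<gamma> \<in> carrier \<Gamma> \<Longrightarrow> x \<gamma> \<in> carrier D"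
  using x_unit by blast

lemma x_mult:
  assumes "\<gamma> \<in> carrier \<Gamma>" "\<tau> \<in> carrier \<Gamma>"
  obtains a where "a \<in> K - {\<zero>}" "x \<gamma> \<otimes> x \<tau> = x (\<gamma> \<otimes>\<^bsub>\<Gamma>\<^esub> \<tau>) \<otimes> a"
  using crossed_product_basis assms unfolding crossed_product_basis_def by blast

lemma scalar_x: "\<gamma> \<in> carrier \<Gamma> \<Longrightarrow> b \<in> K \<Longrightarrow> b \<otimes> x \<gamma> = x \<gamma> \<otimes> \<gamma> b"
  using crossed_product_basis unfolding crossed_product_basis_def by blast

lemma Gal_iso:
  "\<gamma> \<in> carrier \<Gamma> \<Longrightarrow> \<gamma> \<in> ring_iso (D\<lparr>carrier := K\<rparr>) (D\<lparr>carrier := K\<rparr>)"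
  by (simp add: Gal_carrier_iff)

lemma Gal_bij: "\<gamma> \<in> carrier \<Gamma> \<Longrightarrow> bij_betw \<gamma> K K"
  using ring_iso_memE(5)[OF Gal_iso] by simp

lemma Gal_closed: "\<gamma> \<in> carrier \<Gamma> \<Longrightarrow> b \<in> K \<Longrightarrow> \<gamma> b \<in> K"
  using Gal_bij bij_betwE by blast

lemma Gal_eq_zero_iff:
  assumes s: "\<gamma> \<in> carrier \<Gamma>" and b: "b \<in> K"
  shows "\<gamma> b = \<zero> \<longleftrightarrow> b = \<zero>"
proof -
  have z: "\<zero> \<in> K" by (rule subringE(2)[OF subring])
  then have "\<gamma> (\<zero> \<oplus> \<zero>) = \<gamma> \<zero> \<oplus> \<gamma> \<zero>" using ring_iso_memE(3)[OF Gal_iso[OF s], of \<zero> \<zero>] by simp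
  then have "\<gamma> \<zero> = \<gamma> \<zero> \<oplus> \<gamma> \<zero>" by simp
  then have "\<gamma> \<zero> = \<zero>"
    using add.r_cancel_one'[of "\<gamma> \<zero>" "\<gamma> \<zero>"] in_carrier[OF Gal_closed[OF s z]] by simp
  then show ?thesis using Gal_bij[OF s] b z unfolding bij_betw_def inj_on_def by metis
qed

lemma scalar_mult_closed:
  "a \<in> K - {\<zero>} \<Longrightarrow> b \<in> K - {\<zero>} \<Longrightarrow> a \<otimes> b \<in> K - {\<zero>}"
  using subringE(6)[OF subring] subfieldE(5)[OF subfield] by blast

lemma Gal_closed_units: "\<gamma> \<in> carrier \<Gamma> \<Longrightarrow> b \<in> K - {\<zero>} \<Longrightarrow> \<gamma> b \<in> K - {\<zero>}"
  using Gal_closed Gal_eq_zero_iff by blast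

lemma one_scalar: "\<one> \<in> K - {\<zero>}"
  using subringE(3)[OF subring] subfieldE(6)[OF subfield] by blast

lemma scalar_unit:
  assumes "k \<in> K - {\<zero>}"
  shows "k \<in> Units D"
  using subfield_m_inv[OF subfield assms] assms in_carrier unfolding Units_def by blast

text \<open>The first basis vector is a scalar because \<open>x\<^sub>1 x\<^sub>1 = x\<^sub>1 a\<close> with \<open>x\<^sub>1\<close> invertible.\<close>

lemma x_one: "x \<one>\<^bsub>\<Gamma>\<^esub> \<in> K - {\<zero>}"
proof -
  obtain a where a: "a \<in> K - {\<zero>}" "x \<one>\<^bsub>\<Gamma>\<^esub> \<otimes> x \<one>\<^bsub>\<Gamma>\<^esub> = x \<one>\<^bsub>\<Gamma>\<^esub> \<otimes> a"
    using x_mult[of "\<one>\<^bsub>\<Gamma>\<^esub>" "\<one>\<^bsub>\<Gamma>\<^esub>"] by auto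
  then have "x \<one>\<^bsub>\<Gamma>\<^esub> = a"
    using Units_l_cancel[OF x_unit x_carrier, of "\<one>\<^bsub>\<Gamma>\<^esub>" "\<one>\<^bsub>\<Gamma>\<^esub>" a] in_carrier by auto
  with a show ?thesis by simp
qed

lemma scalar_in_line:
  assumes z: "z \<in> K - {\<zero>}"
  obtains k where "k \<in> K - {\<zero>}" "z = x \<one>\<^bsub>\<Gamma>\<^esub> \<otimes> k"
proof
  show "inv (x \<one>\<^bsub>\<Gamma>\<^esub>) \<otimes> z \<in> K - {\<zero>}"
    by (rule scalar_mult_closed[OF subfield_m_inv(1)[OF subfield x_one] z])
  show "z = x \<one>\<^bsub>\<Gamma>\<^esub> \<otimes> (inv (x \<one>\<^bsub>\<Gamma>\<^esub>) \<otimes> z)"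
    using z x_unit[of "\<one>\<^bsub>\<Gamma>\<^esub>"] in_carrier by (simp add: m_assoc[symmetric] Units_closed)
qed

lemma line_mult:
  assumes s: "\<gamma> \<in> carrier \<Gamma>" and t: "\<tau> \<in> carrier \<Gamma>" and k: "k \<in> K - {\<zero>}" and l: "l \<in> K - {\<zero>}"
  obtains m where "m \<in> K - {\<zero>}" "(x \<gamma> \<otimes> k) \<otimes> (x \<tau> \<otimes> l) = x (\<gamma> \<otimes>\<^bsub>\<Gamma>\<^esub> \<tau>) \<otimes> m"
proof -
  obtain a where a: "a \<in> K - {\<zero>}" "x \<gamma> \<otimes> x \<tau> = x (\<gamma> \<otimes>\<^bsub>\<Gamma>\<^esub> \<tau>) \<otimes> a"
    by (rule x_mult[OF s t])
  have c: "k \<in> carrier D" "l \<in> carrier D" "a \<in> carrier D" "\<tau> k \<in> carrier D"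
    using k l a in_carrier Gal_closed[OF t, of k] by auto
  note xc = x_carrier[OF s] x_carrier[OF t] x_carrier[OF Galois.m_closed[OF s t]]
  have "(x \<gamma> \<otimes> k) \<otimes> (x \<tau> \<otimes> l) = x \<gamma> \<otimes> (k \<otimes> x \<tau>) \<otimes> l"
    using c xc by (simp add: m_assoc)
  also have "\<dots> = x \<gamma> \<otimes> x \<tau> \<otimes> (\<tau> k \<otimes> l)"
    using scalar_x[OF t, of k] k c xc by (simp add: m_assoc)
  also have "\<dots> = x (\<gamma> \<otimes>\<^bsub>\<Gamma>\<^esub> \<tau>) \<otimes> (a \<otimes> (\<tau> k \<otimes> l))"
    using a c xc by (simp add: m_assoc)
  finally show ?thesis
    using scalar_mult_closed a k l Gal_closed_units[OF t] that by metis
qed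

lemma line_unit: "\<gamma> \<in> carrier \<Gamma> \<Longrightarrow> k \<in> K - {\<zero>} \<Longrightarrow> x \<gamma> \<otimes> k \<in> Units D"
  using x_unit scalar_unit by simp

lemma coord_closed: "z \<in> carrier D \<Longrightarrow> \<gamma> \<in> carrier \<Gamma> \<Longrightarrow> coord z \<gamma> \<in> K"
  by (rule coords(1)[OF subring basis])

lemma coord_line:
  assumes s: "\<gamma> \<in> carrier \<Gamma>" and k: "k \<in> K" and r: "\<rho> \<in> carrier \<Gamma>"
  shows "coord (x \<gamma> \<otimes> k) \<rho> = (if \<rho> = \<gamma> then k else \<zero>)"
proof (rule coords_eqI[OF subring basis _ _ r])
  show "(\<lambda>\<rho>. if \<rho> = \<gamma> then k else \<zero>) \<in> carrier \<Gamma> \<rightarrow> K"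
    using k subringE(2)[OF subring] by auto
  have "(\<Oplus>\<rho>\<in>carrier \<Gamma>. x \<rho> \<otimes> (if \<rho> = \<gamma> then k else \<zero>)) = x \<gamma> \<otimes> k"
    by (rule finsum_single[OF finite_Gal s]) (use s k x_carrier in_carrier in auto)
  then show "x \<gamma> \<otimes> k = (\<Oplus>\<rho>\<in>carrier \<Gamma>. x \<rho> \<otimes> (if \<rho> = \<gamma> then k else \<zero>))" by simp
qed

lemma line_eq_iff:
  assumes "\<gamma> \<in> carrier \<Gamma>" "\<tau> \<in> carrier \<Gamma>" "k \<in> K - {\<zero>}" "l \<in> K - {\<zero>}"
    and "x \<gamma> \<otimes> k = x \<tau> \<otimes> l"
  shows "\<gamma> = \<tau>"
  using coord_line[of \<gamma> k \<gamma>] coord_line[of \<tau> l \<gamma>] assms by (auto split: if_splits)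

lemma line_of_coord:
  assumes z: "z \<in> carrier D" and s: "\<gamma> \<in> carrier \<Gamma>"
    and zero: "\<And>\<rho>. \<rho> \<in> carrier \<Gamma> \<Longrightarrow> \<rho> \<noteq> \<gamma> \<Longrightarrow> coord z \<rho> = \<zero>"
  shows "z = x \<gamma> \<otimes> coord z \<gamma>"
proof -
  have "(\<Oplus>\<rho>\<in>carrier \<Gamma>. x \<rho> \<otimes> coord z \<rho>) = x \<gamma> \<otimes> coord z \<gamma>"
    by (rule finsum_single[OF finite_Gal s])
      (use s z zero x_carrier in_carrier coord_closed in auto)
  then show ?thesis using coords(2)[OF subring basis z] by simp
qed


section \<open>Monomial and diagonal left multiplications\<close>

text \<open>
  In \<open>z x\<^sub>\<tau> = \<Sum>\<^sub>\<gamma> x\<^sub>\<gamma>\<^sub>\<tau> a\<^sub>\<gamma>\<^sub>,\<^sub>\<tau> \<tau>(c\<^sub>\<gamma>)\<close> the coefficients \<open>a\<^sub>\<gamma>\<^sub>,\<^sub>\<tau>\<close> are nonzero and \<open>\<tau>\<close> is injective, so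
  column \<open>\<tau>\<close> has the zeros of \<open>c\<close>, translated by \<open>\<tau>\<close>.
\<close>

lemma lmult_matrix_eq_zero_iff:
  assumes z: "z \<in> carrier D" and s: "\<gamma> \<in> carrier \<Gamma>" and t: "\<tau> \<in> carrier \<Gamma>"
  shows "mat z (\<gamma> \<otimes>\<^bsub>\<Gamma>\<^esub> \<tau>, \<tau>) = \<zero> \<longleftrightarrow> coord z \<gamma> = \<zero>"
proof -
  let ?c = "coord z" and ?div = "\<lambda>\<rho>. \<rho> \<otimes>\<^bsub>\<Gamma>\<^esub> inv\<^bsub>\<Gamma>\<^esub> \<tau>"
  have "\<forall>\<gamma> \<in> carrier \<Gamma>. \<exists>a. a \<in> K - {\<zero>} \<and> x \<gamma> \<otimes> x \<tau> = x (\<gamma> \<otimes>\<^bsub>\<Gamma>\<^esub> \<tau>) \<otimes> a"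
    using x_mult[OF _ t] by metis
  then obtain a where a: "\<And>\<gamma>. \<gamma> \<in> carrier \<Gamma> \<Longrightarrow> a \<gamma> \<in> K - {\<zero>}"
      "\<And>\<gamma>. \<gamma> \<in> carrier \<Gamma> \<Longrightarrow> x \<gamma> \<otimes> x \<tau> = x (\<gamma> \<otimes>\<^bsub>\<Gamma>\<^esub> \<tau>) \<otimes> a \<gamma>"
    by metis
  have ac: "\<And>\<gamma>. \<gamma> \<in> carrier \<Gamma> \<Longrightarrow> a \<gamma> \<in> carrier D" using a(1) in_carrier by blast
  have cc: "\<And>\<gamma>. \<gamma> \<in> carrier \<Gamma> \<Longrightarrow> ?c \<gamma> \<in> carrier D" using coord_closed[OF z] in_carrier by blast
  have tK: "\<And>\<gamma>. \<gamma> \<in> carrier \<Gamma> \<Longrightarrow> \<tau> (?c \<gamma>) \<in> K" using coord_closed[OF z] Gal_closed[OF t] by blast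
  then have tc: "\<And>\<gamma>. \<gamma> \<in> carrier \<Gamma> \<Longrightarrow> \<tau> (?c \<gamma>) \<in> carrier D" using in_carrier by blast
  have eK: "\<And>\<gamma>. \<gamma> \<in> carrier \<Gamma> \<Longrightarrow> a \<gamma> \<otimes> \<tau> (?c \<gamma>) \<in> K"
    using a(1) tK subringE(6)[OF subring] by blast
  let ?f = "\<lambda>\<rho>. x \<rho> \<otimes> (a (?div \<rho>) \<otimes> \<tau> (?c (?div \<rho>)))"
  have div: "?div (\<gamma> \<otimes>\<^bsub>\<Gamma>\<^esub> \<tau>) = \<gamma>" if "\<gamma> \<in> carrier \<Gamma>" for \<gamma>
    using that t by (simp add: Galois.m_assoc)
  have div_closed: "?div \<rho> \<in> carrier \<Gamma>" if "\<rho> \<in> carrier \<Gamma>" for \<rho>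
    using that t by simp
  have inj: "inj_on (\<lambda>\<gamma>. \<gamma> \<otimes>\<^bsub>\<Gamma>\<^esub> \<tau>) (carrier \<Gamma>)"
    using t by (simp add: Galois.inj_on_multc)
  have surj: "(\<lambda>\<gamma>. \<gamma> \<otimes>\<^bsub>\<Gamma>\<^esub> \<tau>) ` carrier \<Gamma> = carrier \<Gamma>"
  proof
    show "carrier \<Gamma> \<subseteq> (\<lambda>\<gamma>. \<gamma> \<otimes>\<^bsub>\<Gamma>\<^esub> \<tau>) ` carrier \<Gamma>"
    proof
      fix \<rho> assume r: "\<rho> \<in> carrier \<Gamma>"
      then have "\<rho> = ?div \<rho> \<otimes>\<^bsub>\<Gamma>\<^esub> \<tau>" using t by (simp add: Galois.m_assoc)
      then show "\<rho> \<in> (\<lambda>\<gamma>. \<gamma> \<otimes>\<^bsub>\<Gamma>\<^esub> \<tau>) ` carrier \<Gamma>" using div_closed[OF r] by blast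
    qed
  qed (use t in auto)
  have f_closed: "?f \<in> carrier \<Gamma> \<rightarrow> carrier D"
    using x_carrier ac tc div_closed by auto
  have "z \<otimes> x \<tau> = (\<Oplus>\<gamma>\<in>carrier \<Gamma>. x \<gamma> \<otimes> ?c \<gamma>) \<otimes> x \<tau>"
    using coords(2)[OF subring basis z] by simp
  also have "\<dots> = (\<Oplus>\<gamma>\<in>carrier \<Gamma>. x \<gamma> \<otimes> ?c \<gamma> \<otimes> x \<tau>)"
    by (rule finsum_ldistr[OF finite_Gal x_carrier[OF t]]) (use x_carrier cc in auto)
  also have "\<dots> = (\<Oplus>\<gamma>\<in>carrier \<Gamma>. ?f (\<gamma> \<otimes>\<^bsub>\<Gamma>\<^esub> \<tau>))"
  proof (rule finsum_cong')
    fix \<gamma> assume s: "\<gamma> \<in> carrier \<Gamma>"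
    note xc = x_carrier[OF s] x_carrier[OF t] x_carrier[OF Galois.m_closed[OF s t]]
    have "x \<gamma> \<otimes> ?c \<gamma> \<otimes> x \<tau> = x \<gamma> \<otimes> x \<tau> \<otimes> \<tau> (?c \<gamma>)"
      using scalar_x[OF t coord_closed[OF z s]] xc cc[OF s] tc[OF s] by (simp add: m_assoc)
    also have "\<dots> = x (\<gamma> \<otimes>\<^bsub>\<Gamma>\<^esub> \<tau>) \<otimes> (a \<gamma> \<otimes> \<tau> (?c \<gamma>))"
      using a(2)[OF s] xc ac[OF s] tc[OF s] by (simp add: m_assoc)
    finally show "x \<gamma> \<otimes> ?c \<gamma> \<otimes> x \<tau> = ?f (\<gamma> \<otimes>\<^bsub>\<Gamma>\<^esub> \<tau>)" by (simp only: div[OF s])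
  qed (use f_closed t in auto)
  also have "\<dots> = (\<Oplus>\<rho>\<in>carrier \<Gamma>. ?f \<rho>)"
    using finsum_reindex[OF _ inj, of ?f] f_closed unfolding surj by simp
  finally have prod: "z \<otimes> x \<tau> = (\<Oplus>\<rho>\<in>carrier \<Gamma>. ?f \<rho>)" .
  have "mat z (\<gamma> \<otimes>\<^bsub>\<Gamma>\<^esub> \<tau>, \<tau>) = coord (z \<otimes> x \<tau>) (\<gamma> \<otimes>\<^bsub>\<Gamma>\<^esub> \<tau>)"
    using s t by (simp add: lmult_matrix_def)
  also have "\<dots> = a (?div (\<gamma> \<otimes>\<^bsub>\<Gamma>\<^esub> \<tau>)) \<otimes> \<tau> (?c (?div (\<gamma> \<otimes>\<^bsub>\<Gamma>\<^esub> \<tau>)))"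
    by (rule coords_eqI[OF subring basis _ prod]) (use eK div_closed s t in auto)
  finally have "mat z (\<gamma> \<otimes>\<^bsub>\<Gamma>\<^esub> \<tau>, \<tau>) = a \<gamma> \<otimes> \<tau> (?c \<gamma>)" by (simp only: div[OF s])
  moreover have "a \<gamma> \<otimes> \<tau> (?c \<gamma>) = \<zero> \<longleftrightarrow> \<tau> (?c \<gamma>) = \<zero>"
    using subfieldE(5)[OF subfield, of "a \<gamma>" "\<tau> (?c \<gamma>)"] a(1)[OF s] tK[OF s] ac[OF s] by auto
  ultimately show ?thesis using Gal_eq_zero_iff[OF t coord_closed[OF z s]] by simp
qed

lemma lmult_matrix_line_nonzero_iff:
  assumes s: "\<gamma> \<in> carrier \<Gamma>" and k: "k \<in> K - {\<zero>}" and r: "\<rho> \<in> carrier \<Gamma>" and t: "\<tau> \<in> carrier \<Gamma>"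
  shows "mat (x \<gamma> \<otimes> k) (\<rho>, \<tau>) \<noteq> \<zero> \<longleftrightarrow> \<rho> = \<gamma> \<otimes>\<^bsub>\<Gamma>\<^esub> \<tau>"
proof -
  let ?\<mu> = "\<rho> \<otimes>\<^bsub>\<Gamma>\<^esub> inv\<^bsub>\<Gamma>\<^esub> \<tau>"
  have m: "?\<mu> \<in> carrier \<Gamma>" "?\<mu> \<otimes>\<^bsub>\<Gamma>\<^esub> \<tau> = \<rho>" using r t by (auto simp: Galois.m_assoc)
  have "mat (x \<gamma> \<otimes> k) (\<rho>, \<tau>) \<noteq> \<zero> \<longleftrightarrow> coord (x \<gamma> \<otimes> k) ?\<mu> \<noteq> \<zero>"
    using lmult_matrix_eq_zero_iff[OF _ m(1) t, of "x \<gamma> \<otimes> k"] line_unit[OF s k] m(2) by auto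
  also have "\<dots> \<longleftrightarrow> ?\<mu> = \<gamma>" using coord_line[OF s _ m(1), of k] k by auto
  also have "\<dots> \<longleftrightarrow> \<rho> = \<gamma> \<otimes>\<^bsub>\<Gamma>\<^esub> \<tau>" by (rule Galois.inv_solve_right'[OF s r t])
  finally show ?thesis .
qed

lemma lmult_matrix_GL:
  "z \<in> Units D \<Longrightarrow> mat z \<in> carrier (GL (carrier \<Gamma>) (D\<lparr>carrier := K\<rparr>))"
  using lmult_matrix_hom[OF subring basis] by (auto simp: hom_def units_of_carrier)

lemma stab_units_eq:
  "stab_units D F K x = {x \<gamma> \<otimes> k | \<gamma> k. \<gamma> \<in> carrier \<Gamma> \<and> k \<in> K - {\<zero>}}"
proof (intro equalityI subsetI)
  fix z assume "z \<in> stab_units D F K x"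
  then have z: "z \<in> Units D" and mono: "mat z \<in> monomial_matrices (carrier \<Gamma>) (D\<lparr>carrier := K\<rparr>)"
    by (auto simp: stab_units_def)
  \<comment> \<open>The column of \<open>\<tau> = 1\<close> has the zero pattern of the coordinates of \<open>z\<close>.\<close>
  have col: "mat z (\<gamma>, \<one>\<^bsub>\<Gamma>\<^esub>) = \<zero> \<longleftrightarrow> coord z \<gamma> = \<zero>" if "\<gamma> \<in> carrier \<Gamma>" for \<gamma>
    using lmult_matrix_eq_zero_iff[of z \<gamma> "\<one>\<^bsub>\<Gamma>\<^esub>"] z that by auto
  have "\<exists>!\<gamma>. \<gamma> \<in> carrier \<Gamma> \<and> mat z (\<gamma>, \<one>\<^bsub>\<Gamma>\<^esub>) \<noteq> \<zero>"
    using mono by (simp add: monomial_matrices_def)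
  then obtain \<gamma> where s: "\<gamma> \<in> carrier \<Gamma>" "coord z \<gamma> \<noteq> \<zero>"
      "\<And>\<rho>. \<rho> \<in> carrier \<Gamma> \<Longrightarrow> \<rho> \<noteq> \<gamma> \<Longrightarrow> coord z \<rho> = \<zero>"
    using col by metis
  then have "z = x \<gamma> \<otimes> coord z \<gamma>" "coord z \<gamma> \<in> K - {\<zero>}"
    using z coord_closed by (auto intro!: line_of_coord)
  with s(1) show "z \<in> {x \<gamma> \<otimes> k | \<gamma> k. \<gamma> \<in> carrier \<Gamma> \<and> k \<in> K - {\<zero>}}" by blast
next
  fix z assume "z \<in> {x \<gamma> \<otimes> k | \<gamma> k. \<gamma> \<in> carrier \<Gamma> \<and> k \<in> K - {\<zero>}}"
  then obtain \<gamma> k where s: "\<gamma> \<in> carrier \<Gamma>" and k: "k \<in> K - {\<zero>}" and z: "z = x \<gamma> \<otimes> k" by blast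
  note entry = lmult_matrix_line_nonzero_iff[OF s k, folded z]
  have zU: "z \<in> Units D" unfolding z by (rule line_unit[OF s k])
  have row: "\<exists>!\<tau>. \<tau> \<in> carrier \<Gamma> \<and> mat z (\<rho>, \<tau>) \<noteq> \<zero>" if r: "\<rho> \<in> carrier \<Gamma>" for \<rho>
  proof (rule ex1I[of _ "inv\<^bsub>\<Gamma>\<^esub> \<gamma> \<otimes>\<^bsub>\<Gamma>\<^esub> \<rho>"])
    show "inv\<^bsub>\<Gamma>\<^esub> \<gamma> \<otimes>\<^bsub>\<Gamma>\<^esub> \<rho> \<in> carrier \<Gamma> \<and> mat z (\<rho>, inv\<^bsub>\<Gamma>\<^esub> \<gamma> \<otimes>\<^bsub>\<Gamma>\<^esub> \<rho>) \<noteq> \<zero>"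
      using entry[OF r, of "inv\<^bsub>\<Gamma>\<^esub> \<gamma> \<otimes>\<^bsub>\<Gamma>\<^esub> \<rho>"] s r by (simp add: Galois.m_assoc[symmetric])
    show "\<tau> = inv\<^bsub>\<Gamma>\<^esub> \<gamma> \<otimes>\<^bsub>\<Gamma>\<^esub> \<rho>" if "\<tau> \<in> carrier \<Gamma> \<and> mat z (\<rho>, \<tau>) \<noteq> \<zero>" for \<tau>
      using entry[OF r, of \<tau>] that s by (simp add: Galois.m_assoc[symmetric])
  qed
  have col: "\<exists>!\<rho>. \<rho> \<in> carrier \<Gamma> \<and> mat z (\<rho>, \<tau>) \<noteq> \<zero>" if t: "\<tau> \<in> carrier \<Gamma>" for \<tau>
    using entry[OF _ t] Galois.m_closed[OF s t] by blast
  show "z \<in> stab_units D F K x"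
    using zU lmult_matrix_GL[OF zU] row col by (simp add: stab_units_def monomial_matrices_def)
qed

lemma fix_units_eq: "fix_units D F K x = K - {\<zero>}"
proof (intro equalityI subsetI)
  fix z assume "z \<in> fix_units D F K x"
  then have z: "z \<in> Units D" and diag: "mat z \<in> diagonal_matrices (carrier \<Gamma>) (D\<lparr>carrier := K\<rparr>)"
    by (auto simp: fix_units_def)
  have "coord z \<rho> = \<zero>" if "\<rho> \<in> carrier \<Gamma>" "\<rho> \<noteq> \<one>\<^bsub>\<Gamma>\<^esub>" for \<rho>
    using lmult_matrix_eq_zero_iff[of z \<rho> "\<one>\<^bsub>\<Gamma>\<^esub>"] z diag that by (auto simp: diagonal_matrices_def)
  then have eq: "z = x \<one>\<^bsub>\<Gamma>\<^esub> \<otimes> coord z \<one>\<^bsub>\<Gamma>\<^esub>" using z by (intro line_of_coord) auto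
  have "z \<noteq> \<zero>" using z one_scalar unfolding Units_def by auto
  moreover have "z \<in> K"
    using x_one coord_closed[of z "\<one>\<^bsub>\<Gamma>\<^esub>"] z by (subst eq) (auto intro!: subringE(6)[OF subring])
  ultimately show "z \<in> K - {\<zero>}" by simp
next
  fix z assume z: "z \<in> K - {\<zero>}"
  then obtain k where k: "k \<in> K - {\<zero>}" and eq: "z = x \<one>\<^bsub>\<Gamma>\<^esub> \<otimes> k" by (rule scalar_in_line)
  have "mat z (\<rho>, \<tau>) = \<zero>" if "\<rho> \<in> carrier \<Gamma>" "\<tau> \<in> carrier \<Gamma>" "\<rho> \<noteq> \<tau>" for \<rho> \<tau>
    using lmult_matrix_line_nonzero_iff[OF _ k that(1,2), of "\<one>\<^bsub>\<Gamma>\<^esub>"] that eq by auto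
  then show "z \<in> fix_units D F K x"
    using scalar_unit[OF z] lmult_matrix_GL by (simp add: fix_units_def diagonal_matrices_def)
qed


section \<open>The Weyl group\<close>

abbreviation N :: "'a monoid" where "N \<equiv> stab_group D F K x"

lemma N_carrier: "carrier N = {x \<gamma> \<otimes> k | \<gamma> k. \<gamma> \<in> carrier \<Gamma> \<and> k \<in> K - {\<zero>}}"
  by (simp add: stab_group_def stab_units_eq)

lemma N_mult: "a \<otimes>\<^bsub>N\<^esub> b = a \<otimes> b"
  by (simp add: stab_group_def units_of_mult)

lemma line_in_stab: "\<gamma> \<in> carrier \<Gamma> \<Longrightarrow> k \<in> K - {\<zero>} \<Longrightarrow> x \<gamma> \<otimes> k \<in> stab_units D F K x"
  by (auto simp: stab_units_eq)

lemma x_in_stab: "\<gamma> \<in> carrier \<Gamma> \<Longrightarrow> x \<gamma> \<in> stab_units D F K x"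
  using line_in_stab[OF _ one_scalar] x_carrier by simp

lemma scalars_in_stab: "K - {\<zero>} \<subseteq> stab_units D F K x"
proof
  fix z assume "z \<in> K - {\<zero>}"
  then show "z \<in> stab_units D F K x" using scalar_in_line line_in_stab Galois.one_closed by metis
qed

lemma stab_subgroup: "subgroup (stab_units D F K x) (units_of D)"
proof -
  interpret U: group "units_of D" by (rule units_group)
  show ?thesis
  proof (rule U.subgroupI)
    show "stab_units D F K x \<subseteq> carrier (units_of D)"
      by (auto simp: stab_units_def units_of_carrier)
    show "stab_units D F K x \<noteq> {}" using x_in_stab Galois.one_closed by blast
  next
    fix a b assume "a \<in> stab_units D F K x" "b \<in> stab_units D F K x"
    then obtain \<gamma> k \<tau> l where st: "\<gamma> \<in> carrier \<Gamma>" "\<tau> \<in> carrier \<Gamma>" "k \<in> K - {\<zero>}" "l \<in> K - {\<zero>}"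
        and ab: "a = x \<gamma> \<otimes> k" "b = x \<tau> \<otimes> l"
      unfolding stab_units_eq by blast
    obtain m where "m \<in> K - {\<zero>}" "a \<otimes> b = x (\<gamma> \<otimes>\<^bsub>\<Gamma>\<^esub> \<tau>) \<otimes> m"
      unfolding ab by (rule line_mult[OF st])
    then show "a \<otimes>\<^bsub>units_of D\<^esub> b \<in> stab_units D F K x"
      using line_in_stab st by (simp add: units_of_mult)
  next
    fix a assume aS: "a \<in> stab_units D F K x"
    then obtain \<gamma> k where s: "\<gamma> \<in> carrier \<Gamma>" and k: "k \<in> K - {\<zero>}" and a: "a = x \<gamma> \<otimes> k"
      unfolding stab_units_eq by blast
    let ?\<rho> = "inv\<^bsub>\<Gamma>\<^esub> \<gamma>"
    have r: "?\<rho> \<in> carrier \<Gamma>" using s by simp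
    have aU: "a \<in> Units D" unfolding a by (rule line_unit[OF s k])
    obtain m where m: "m \<in> K - {\<zero>}" "a \<otimes> (x ?\<rho> \<otimes> \<one>) = x (\<gamma> \<otimes>\<^bsub>\<Gamma>\<^esub> ?\<rho>) \<otimes> m"
      unfolding a by (rule line_mult[OF s r k one_scalar])
    \<comment> \<open>Since \<open>x\<^sub>\<gamma> k x\<^sub>\<rho>\<close> is a scalar for \<open>\<rho> = \<gamma>\<inverse>\<close>, the inverse of \<open>x\<^sub>\<gamma> k\<close> lies on the line of \<open>x\<^sub>\<rho>\<close>.\<close>
    define n where "n = x \<one>\<^bsub>\<Gamma>\<^esub> \<otimes> m"
    have n: "n \<in> K - {\<zero>}" unfolding n_def by (rule scalar_mult_closed[OF x_one m(1)])
    have an: "a \<otimes> x ?\<rho> = n" using m(2) s x_carrier[OF r] by (simp add: n_def)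
    note inv_n = subfield_m_inv[OF subfield n]
    have w: "x ?\<rho> \<otimes> inv n \<in> Units D" by (rule line_unit[OF r inv_n(1)])
    have "a \<otimes> (x ?\<rho> \<otimes> inv n) = a \<otimes> x ?\<rho> \<otimes> inv n"
      using aU x_carrier[OF r] in_carrier inv_n(1) by (simp add: m_assoc Units_closed)
    then have "a \<otimes> (x ?\<rho> \<otimes> inv n) = \<one>" using an inv_n(2) by simp
    then have "inv\<^bsub>units_of D\<^esub> a = x ?\<rho> \<otimes> inv n"
      using U.inv_unique[OF U.l_inv, of a "x ?\<rho> \<otimes> inv n"] U.inv_closed[of a] aU w
      by (simp add: units_of_mult units_of_one units_of_carrier)
    then show "inv\<^bsub>units_of D\<^esub> a \<in> stab_units D F K x"
      using line_in_stab[OF r inv_n(1)] by simp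
  qed
qed

lemma scalars_subgroup: "subgroup (K - {\<zero>}) (units_of D)"
proof -
  interpret U: group "units_of D" by (rule units_group)
  show ?thesis
  proof (rule U.subgroupI)
    show "K - {\<zero>} \<subseteq> carrier (units_of D)" using scalar_unit by (auto simp: units_of_carrier)
    show "K - {\<zero>} \<noteq> {}" using one_scalar by blast
    show "inv\<^bsub>units_of D\<^esub> a \<in> K - {\<zero>}" if "a \<in> K - {\<zero>}" for a
      using subfield_m_inv(1)[OF subfield that] units_of_inv[OF scalar_unit[OF that]] by simp
    show "a \<otimes>\<^bsub>units_of D\<^esub> b \<in> K - {\<zero>}" if "a \<in> K - {\<zero>}" "b \<in> K - {\<zero>}" for a b
      using scalar_mult_closed[OF that] by (simp add: units_of_mult)
  qed
qed

lemma scalar_line_commute: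
  assumes s: "\<gamma> \<in> carrier \<Gamma>" and k: "k \<in> K" and b: "b \<in> K"
  shows "b \<otimes> (x \<gamma> \<otimes> k) = x \<gamma> \<otimes> k \<otimes> \<gamma> b"
proof -
  have sb: "\<gamma> b \<in> K" by (rule Gal_closed[OF s b])
  note c = x_carrier[OF s] in_carrier[OF k] in_carrier[OF b] in_carrier[OF sb]
  have "b \<otimes> (x \<gamma> \<otimes> k) = x \<gamma> \<otimes> (\<gamma> b \<otimes> k)"
    using scalar_x[OF s b] c by (simp add: m_assoc[symmetric])
  then show ?thesis using subfieldE(4)[OF subfield sb k] c by (simp add: m_assoc)
qed

text \<open>Left and right cosets of \<open>K\<^sup>\<times>\<close> agree because \<open>b\<close> moves past \<open>x\<^sub>\<gamma> k\<close> as \<open>\<gamma>(b)\<close>, and \<open>\<gamma>\<close> permutes \<open>K\<^sup>\<times>\<close>.\<close>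

lemma fix_normal: "fix_units D F K x \<lhd> N"
proof -
  interpret U: group "units_of D" by (rule units_group)
  interpret N: group N
    unfolding stab_group_def by (rule U.subgroup_imp_group[OF stab_subgroup])
  have "subgroup (K - {\<zero>}) N"
    unfolding stab_group_def
    by (rule U.subgroup_incl[OF scalars_subgroup stab_subgroup scalars_in_stab])
  moreover have "(K - {\<zero>}) #>\<^bsub>N\<^esub> z = z <#\<^bsub>N\<^esub> (K - {\<zero>})" if "z \<in> carrier N" for z
  proof -
    obtain \<gamma> k where s: "\<gamma> \<in> carrier \<Gamma>" and k: "k \<in> K" and z: "z = x \<gamma> \<otimes> k"
      using \<open>z \<in> carrier N\<close> unfolding N_carrier by blast
    have "\<gamma> ` (K - {\<zero>}) = K - {\<zero>}"
      using Gal_bij[OF s] Gal_eq_zero_iff[OF s] by (auto simp: bij_betw_def)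
    moreover have "(K - {\<zero>}) #>\<^bsub>N\<^esub> z = (\<lambda>b. z \<otimes> b) ` \<gamma> ` (K - {\<zero>})"
      using scalar_line_commute[OF s k] by (auto simp: r_coset_def N_mult z)
    ultimately show ?thesis by (auto simp: l_coset_def N_mult)
  qed
  ultimately show ?thesis unfolding fix_units_eq by (intro N.normalI) auto
qed

lemma gal_to_weyl_eq: "gal_to_weyl D F K x \<gamma> = (\<lambda>k. x \<gamma> \<otimes> k) ` (K - {\<zero>})"
  by (auto simp: gal_to_weyl_def fix_units_eq l_coset_def units_of_mult)

lemma stab_units_eq_Union: "stab_units D F K x = (\<Union>\<gamma>\<in>carrier \<Gamma>. gal_to_weyl D F K x \<gamma>)"
  unfolding stab_units_eq gal_to_weyl_eq by blast

lemma line_rescale: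
  assumes g: "\<gamma> \<in> carrier \<Gamma>" and k: "k \<in> K - {\<zero>}"
  shows "(x \<gamma> \<otimes> k) <#\<^bsub>units_of D\<^esub> (K - {\<zero>}) = gal_to_weyl D F K x \<gamma>"
proof -
  interpret U: group "units_of D" by (rule units_group)
  have U: "x \<gamma> \<in> carrier (units_of D)" "k \<in> carrier (units_of D)" "K - {\<zero>} \<subseteq> carrier (units_of D)"
    using x_unit[OF g] scalar_unit k by (auto simp: units_of_carrier)
  have "(x \<gamma> \<otimes> k) <#\<^bsub>units_of D\<^esub> (K - {\<zero>}) = x \<gamma> <#\<^bsub>units_of D\<^esub> (k <#\<^bsub>units_of D\<^esub> (K - {\<zero>}))"
    using U.lcos_m_assoc[OF U(3,1,2)] by (simp add: units_of_mult)
  also have "k <#\<^bsub>units_of D\<^esub> (K - {\<zero>}) = K - {\<zero>}"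
    by (rule U.coset_join3[OF U(2) scalars_subgroup k])
  finally show ?thesis by (simp add: gal_to_weyl_def fix_units_eq)
qed

text \<open>
  Because \<open>K\<^sup>\<times>\<close> absorbs \<open>k\<close>, all of \<open>x\<^sub>\<gamma> K\<^sup>\<times>\<close> is one coset of the fixer. As these lines exhaust the stabilizer, the map from the
  Galois group to the cosets is onto; and since \<open>x\<^sub>\<gamma> x\<^sub>\<tau>\<close> differs from \<open>x\<^sub>\<gamma>\<^sub>\<tau>\<close> only by a scalar, it is
  multiplicative.
\<close>

lemma coset_of_line:
  assumes g: "\<gamma> \<in> carrier \<Gamma>" and k: "k \<in> K - {\<zero>}"
  shows "fix_units D F K x #>\<^bsub>N\<^esub> (x \<gamma> \<otimes> k) = gal_to_weyl D F K x \<gamma>"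
proof -
  interpret normal "fix_units D F K x" N by (rule fix_normal)
  have "fix_units D F K x #>\<^bsub>N\<^esub> (x \<gamma> \<otimes> k) = (x \<gamma> \<otimes> k) <#\<^bsub>N\<^esub> fix_units D F K x"
    using coset_eq line_in_stab[OF g k] by (simp add: stab_group_def)
  then show ?thesis using line_rescale[OF g k] by (simp add: stab_group_def fix_units_eq)
qed

lemma gal_to_weyl_iso: "gal_to_weyl D F K x \<in> iso \<Gamma> (weyl_group D F K x)"
proof -
  interpret normal "fix_units D F K x" N by (rule fix_normal)
  let ?\<phi> = "gal_to_weyl D F K x"
  have coset: "?\<phi> \<gamma> = fix_units D F K x #>\<^bsub>N\<^esub> x \<gamma>" if "\<gamma> \<in> carrier \<Gamma>" for \<gamma>
    using coset_of_line[OF that one_scalar] x_carrier[OF that] by simp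
  have xN: "x \<gamma> \<in> carrier N" if "\<gamma> \<in> carrier \<Gamma>" for \<gamma>
    using x_in_stab[OF that] by (simp add: stab_group_def)
  have "?\<phi> \<in> hom \<Gamma> (weyl_group D F K x)"
  proof (rule homI)
    fix \<gamma> assume "\<gamma> \<in> carrier \<Gamma>"
    then show "?\<phi> \<gamma> \<in> carrier (weyl_group D F K x)"
      using coset xN rcosetsI[OF subset] by (simp add: weyl_group_def FactGroup_def)
  next
    fix \<gamma> \<tau> assume st: "\<gamma> \<in> carrier \<Gamma>" "\<tau> \<in> carrier \<Gamma>"
    obtain a where a: "a \<in> K - {\<zero>}" "x \<gamma> \<otimes> x \<tau> = x (\<gamma> \<otimes>\<^bsub>\<Gamma>\<^esub> \<tau>) \<otimes> a" by (rule x_mult[OF st])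
    have "?\<phi> \<gamma> <#>\<^bsub>N\<^esub> ?\<phi> \<tau> = fix_units D F K x #>\<^bsub>N\<^esub> (x \<gamma> \<otimes>\<^bsub>N\<^esub> x \<tau>)"
      using rcos_sum[OF xN[OF st(1)] xN[OF st(2)]] coset st by simp
    also have "\<dots> = ?\<phi> (\<gamma> \<otimes>\<^bsub>\<Gamma>\<^esub> \<tau>)"
      using coset_of_line[OF Galois.m_closed[OF st] a(1)] a(2) by (simp add: N_mult)
    finally show "?\<phi> (\<gamma> \<otimes>\<^bsub>\<Gamma>\<^esub> \<tau>) = ?\<phi> \<gamma> \<otimes>\<^bsub>weyl_group D F K x\<^esub> ?\<phi> \<tau>"
      by (simp add: weyl_group_def FactGroup_def)
  qed
  moreover have "inj_on ?\<phi> (carrier \<Gamma>)"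
  proof (rule inj_onI)
    fix \<gamma> \<tau> assume st: "\<gamma> \<in> carrier \<Gamma>" "\<tau> \<in> carrier \<Gamma>" "?\<phi> \<gamma> = ?\<phi> \<tau>"
    have "x \<gamma> \<otimes> \<one> \<in> ?\<phi> \<tau>" using gal_to_weyl_eq[of \<gamma>] imageI[OF one_scalar, of "\<lambda>k. x \<gamma> \<otimes> k"] st(3) by simp
    then show "\<gamma> = \<tau>" using line_eq_iff[OF st(1,2) one_scalar] unfolding gal_to_weyl_eq by blast
  qed
  moreover have "?\<phi> ` carrier \<Gamma> = carrier (weyl_group D F K x)"
  proof
    show "?\<phi> ` carrier \<Gamma> \<subseteq> carrier (weyl_group D F K x)"
      using calculation(1) by (auto simp: hom_def)
    show "carrier (weyl_group D F K x) \<subseteq> ?\<phi> ` carrier \<Gamma>"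
    proof
      fix w assume "w \<in> carrier (weyl_group D F K x)"
      then obtain z where "z \<in> carrier N" "w = fix_units D F K x #>\<^bsub>N\<^esub> z"
        by (auto simp: weyl_group_def FactGroup_def RCOSETS_def)
      then show "w \<in> ?\<phi> ` carrier \<Gamma>" using coset_of_line unfolding N_carrier by blast
    qed
  qed
  ultimately show ?thesis by (simp add: iso_def bij_betw_def)
qed


section \<open>Independence of the basis\<close>

text \<open>
  Writing \<open>y = \<Sum>\<^sub>\<tau> x\<^sub>\<tau> c\<^sub>\<tau>\<close>, the coordinates of \<open>b y\<close> and \<open>y \<gamma>(b)\<close> at \<open>\<tau>\<close> are \<open>\<tau>(b) c\<^sub>\<tau>\<close> and \<open>c\<^sub>\<tau> \<gamma>(b)\<close>.
  If \<open>c\<^sub>\<tau> \<noteq> 0\<close>, commutativity of \<open>K\<close> lets \<open>c\<^sub>\<tau>\<close> be cancelled, so they agree for all \<open>b\<close> only when \<open>\<tau> = \<gamma>\<close>.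
\<close>

lemma intertwiner_in_line:
  assumes s: "\<gamma> \<in> carrier \<Gamma>" and y: "y \<in> Units D"
    and intertwines: "\<And>b. b \<in> K \<Longrightarrow> b \<otimes> y = y \<otimes> \<gamma> b"
  obtains k where "k \<in> K - {\<zero>}" "y = x \<gamma> \<otimes> k"
proof
  have yc: "y \<in> carrier D" using y by blast
  have cK: "\<And>\<tau>. \<tau> \<in> carrier \<Gamma> \<Longrightarrow> coord y \<tau> \<in> K" by (rule coord_closed[OF yc])
  then have cc: "\<And>\<tau>. \<tau> \<in> carrier \<Gamma> \<Longrightarrow> coord y \<tau> \<in> carrier D" using in_carrier by blast
  have sum: "y = (\<Oplus>\<tau>\<in>carrier \<Gamma>. x \<tau> \<otimes> coord y \<tau>)" using coords(2)[OF subring basis yc] by simp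
  have zero: "coord y \<tau> = \<zero>" if t: "\<tau> \<in> carrier \<Gamma>" and ne: "\<tau> \<noteq> \<gamma>" for \<tau>
  proof (rule ccontr)
    assume nz: "coord y \<tau> \<noteq> \<zero>"
    have "\<tau> b = \<gamma> b" if b: "b \<in> K" for b
    proof -
      have bc: "b \<in> carrier D" and sbK: "\<gamma> b \<in> K" and tbK: "\<tau> b \<in> K"
        using b in_carrier Gal_closed s t by auto
      have sb: "\<gamma> b \<in> carrier D" and tb: "\<tau> b \<in> carrier D" using sbK tbK in_carrier by auto
      have "b \<otimes> y = (\<Oplus>\<tau>\<in>carrier \<Gamma>. b \<otimes> (x \<tau> \<otimes> coord y \<tau>))"
        by (subst sum, rule finsum_rdistr[OF finite_Gal bc]) (use x_carrier cc in auto)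
      also have "\<dots> = (\<Oplus>\<tau>\<in>carrier \<Gamma>. x \<tau> \<otimes> (coord y \<tau> \<otimes> \<tau> b))"
        by (rule finsum_cong')
          (use x_carrier cc in_carrier Gal_closed b scalar_line_commute[OF _ cK b] in
            \<open>auto simp: m_assoc\<close>)
      finally have l: "coord (b \<otimes> y) \<tau> = coord y \<tau> \<otimes> \<tau> b"
        by (intro coords_eqI[OF subring basis _ _ t])
          (use cK Gal_closed b subringE(6)[OF subring] in auto)
      have "y \<otimes> \<gamma> b = (\<Oplus>\<tau>\<in>carrier \<Gamma>. x \<tau> \<otimes> coord y \<tau> \<otimes> \<gamma> b)"
        by (subst sum, rule finsum_ldistr[OF finite_Gal sb]) (use x_carrier cc in auto)
      also have "\<dots> = (\<Oplus>\<tau>\<in>carrier \<Gamma>. x \<tau> \<otimes> (coord y \<tau> \<otimes> \<gamma> b))"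
        by (rule finsum_cong') (use x_carrier cc sb in \<open>auto simp: m_assoc\<close>)
      finally have r: "coord (y \<otimes> \<gamma> b) \<tau> = coord y \<tau> \<otimes> \<gamma> b"
        by (intro coords_eqI[OF subring basis _ _ t])
          (use cK sbK subringE(6)[OF subring] in auto)
      have "coord y \<tau> \<otimes> \<tau> b = coord y \<tau> \<otimes> \<gamma> b" using l r intertwines[OF b] by simp
      then show ?thesis
        using Units_l_cancel[OF scalar_unit tb sb] cK[OF t] nz by blast
    qed
    then have "\<tau> = \<gamma>"
      using s t by (intro extensionalityI[of _ K]) (auto simp: Gal_carrier_iff)
    with ne show False by simp
  qed
  show eq: "y = x \<gamma> \<otimes> coord y \<gamma>" by (rule line_of_coord[OF yc s zero])
  have "coord y \<gamma> \<noteq> \<zero>"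
  proof
    assume "coord y \<gamma> = \<zero>"
    then have "y = \<zero>" using eq x_carrier[OF s] by simp
    then show False using y one_scalar unfolding Units_def by auto
  qed
  then show "coord y \<gamma> \<in> K - {\<zero>}" using cK[OF s] by simp
qed

lemma weyl_group_basis_independent:
  assumes y: "crossed_product_basis D F K y"
  shows "weyl_group D F K y = weyl_group D F K x"
    and "\<gamma> \<in> carrier \<Gamma> \<Longrightarrow> gal_to_weyl D F K y \<gamma> = gal_to_weyl D F K x \<gamma>"
proof -
  interpret Y: crossed_product D F K y
    by (intro crossed_product.intro crossed_product_axioms.intro ring_axioms subfield fixed_le y)
  have line: "gal_to_weyl D F K y \<gamma> = gal_to_weyl D F K x \<gamma>" if g: "\<gamma> \<in> carrier \<Gamma>" for \<gamma>
  proof -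
    obtain k where k: "k \<in> K - {\<zero>}" and eq: "y \<gamma> = x \<gamma> \<otimes> k"
      by (rule intertwiner_in_line[OF g Y.x_unit[OF g] Y.scalar_x[OF g]])
    show ?thesis
      using line_rescale[OF g k] by (simp add: gal_to_weyl_def[of D F K y] Y.fix_units_eq eq)
  qed
  then have "stab_units D F K y = stab_units D F K x"
    unfolding Y.stab_units_eq_Union stab_units_eq_Union by (rule SUP_cong[OF refl])
  then show "weyl_group D F K y = weyl_group D F K x"
    by (simp add: weyl_group_def stab_group_def fix_units_eq Y.fix_units_eq)
  show "gal_to_weyl D F K y \<gamma> = gal_to_weyl D F K x \<gamma>" if "\<gamma> \<in> carrier \<Gamma>"
    by (rule line[OF that])
qed

end

theorem proposition5p1:
  fixes D :: "('a, 'm) ring_scheme" and F K :: "'a set" and d :: nat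
    and x :: "('a \<Rightarrow> 'a) \<Rightarrow> 'a"
  assumes "division_algebra D F d"
    and "maximal_subfield K D"
    and "galois_extension D F K"
    and "crossed_product_basis D F K x"
  shows "fix_units D F K x \<lhd> stab_group D F K x
    \<and> gal_to_weyl D F K x \<in> iso (Gal D F K) (weyl_group D F K x)
    \<and> (\<forall>y. crossed_product_basis D F K y \<longrightarrow>
          weyl_group D F K y = weyl_group D F K x
          \<and> (\<forall>\<sigma> \<in> carrier (Gal D F K). gal_to_weyl D F K y \<sigma> = gal_to_weyl D F K x \<sigma>))"
proof -
  interpret division_algebra D F d by (rule assms(1))
  interpret crossed_product D F K x
    by (intro crossed_product.intro crossed_product_axioms.intro ring_axioms)
      (use assms in \<open>auto simp: maximal_subfield_def galois_extension_def\<close>)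
  show ?thesis using fix_normal gal_to_weyl_iso weyl_group_basis_independent by blast
qed

end
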